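(* Let $\mathbb{G}=(V,E,T)$ be a temporal graph and $\Delta\in\mathbb{N}$. If the procedure $\textsc{BronKerboschDelta}(P,R,X)$ described in the context is run on input $P=V\times\{T\}$, $R=(\emptyset,T)$, $X=\emptyset$, then it adds all maximal $\Delta$-cliques of $\mathbb{G}$, and only these, to the solution.
   Context: A temporal graph $\mathbb{G}=(V,E,T)$ consists of a finite vertex set $V$, an integer time interval $T=[\alpha,\omega]$, and a set of time-edges $E\subseteq\binom{V}{2}\times T$. All intervals are intervals of integers; for an interval $J=[a,b]$ write $|J|=b-a$. A $\Delta$-clique is a tuple $(C,I=[a,b])$ with $C\subseteq V$, $b-a\ge\Delta$, $I\subseteq T$, such that for all $\tau\in[a,b-\Delta]$ and all distinct $v,w\in C$ there is $(\{v,w\},t)\in E$ with $t\in[\tau,\tau+\Delta]$. It is vertex-maximal if there is no $\Delta$-clique $(C',I')$ with $I\subseteq I'$ and $C\subsetneq C'$; time-maximal if there is no $\Delta$-clique $(C',I')$ with $I\subsetneq I'$ and $C\subseteq C'$; maximal if both. A vertex-interval pair is a tuple $(v,I)$ with $v\in V$, $I\subseteq T$ an interval. $\Delta$-neighborhood: $N^{\Delta}(v,I)$ is the set of all $(w,I'=[a',b'])$ such that $b'-a'\ge\Delta$, $I'\subseteq I$, for every $\tau\in[a',b'-\Delta]$ there is $(\{v,w\},t)\in E$ with $t\in[\tau,\tau+\Delta]$, and $I'$ is inclusion-maximal among subintervals of $I$ with these properties. $\Delta$-cut: $Y\sqcap Z=\{(v,I\cap I')\mid (v,I)\in Y,\ (v,I')\in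 Z,\ |I\cap I'|\ge\Delta\}$. Procedure $\textsc{BronKerboschDelta}(P,R=(C,I),X)$, with $P,X$ sets of vertex-interval pairs: (1) if every $(w,I')\in P\cup X$ satisfies $I'\subsetneq I$, add $R$ to the solution; (2) for each $(v,I')\in P$ (iterating over the current $P$): set $R'=(C\cup\{v\},I')$, $P'=P\sqcap N^{\Delta}(v,I')$, $X'=X\sqcap N^{\Delta}(v,I')$, call $\textsc{BronKerboschDelta}(P',R',X')$, then remove $(v,I')$ from $P$ and add it to $X$.
   Formalization: The formal theorem additionally assumes |T| ≥ Δ; if |T| < Δ there are no Δ-cliques, yet the procedure adds ({v},T) for each vertex v (or (∅,T) if V is empty), so the claim is false in every excluded case. *)

theory Defs
  imports Main
begin

record 'v tgraph =
  verts :: "'v set"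
  tedges :: "('v set \<times> int) set"
  lifetime :: "int set"

definition temporal_graph :: "'v tgraph \<Rightarrow> bool" where
  "temporal_graph G \<longleftrightarrow>
     finite (verts G) \<and>
     (\<exists>\<alpha> \<omega>. \<alpha> \<le> \<omega> \<and> lifetime G = {\<alpha>..\<omega>}) \<and>
     tedges G \<subseteq> {e. e \<subseteq> verts G \<and> card e = 2} \<times> lifetime G"

(* An interval [a,b] has length b - a (not its number of elements).  As \<Delta> is a natural
   number, the condition below forces a \<le> b, so the empty set is never long enough. *)
definition ivl_length_ge :: "nat \<Rightarrow> int set \<Rightarrow> bool" where
  "ivl_length_ge \<Delta> J \<longleftrightarrow> (\<exists>a b. J = {a..b} \<and> b - a \<ge> int \<Delta>)"

definition delta_clique :: "'v tgraph \<Rightarrow> nat \<Rightarrow> 'v set \<times> int set \<Rightarrow> bool" where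
  "delta_clique G \<Delta> = (\<lambda>(C, I). C \<subseteq> verts G \<and> I \<subseteq> lifetime G \<and>
     (\<exists>a b. I = {a..b} \<and> b - a \<ge> int \<Delta> \<and>
       (\<forall>\<tau>\<in>{a..b - int \<Delta>}. \<forall>v\<in>C. \<forall>w\<in>C. v \<noteq> w \<longrightarrow>
          (\<exists>t\<in>{\<tau>..\<tau> + int \<Delta>}. ({v, w}, t) \<in> tedges G))))"

definition vertex_maximal :: "'v tgraph \<Rightarrow> nat \<Rightarrow> 'v set \<times> int set \<Rightarrow> bool" where
  "vertex_maximal G \<Delta> = (\<lambda>(C, I).
     \<not> (\<exists>C' I'. delta_clique G \<Delta> (C', I') \<and> I \<subseteq> I' \<and> C \<subset> C'))"

definition time_maximal :: "'v tgraph \<Rightarrow> nat \<Rightarrow> 'v set \<times> int set \<Rightarrow> bool" where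
  "time_maximal G \<Delta> = (\<lambda>(C, I).
     \<not> (\<exists>C' I'. delta_clique G \<Delta> (C', I') \<and> I \<subset> I' \<and> C \<subseteq> C'))"

definition maximal_delta_clique :: "'v tgraph \<Rightarrow> nat \<Rightarrow> 'v set \<times> int set \<Rightarrow> bool" where
  "maximal_delta_clique G \<Delta> R \<longleftrightarrow>
     delta_clique G \<Delta> R \<and> vertex_maximal G \<Delta> R \<and> time_maximal G \<Delta> R"

definition neighbor_ivl :: "'v tgraph \<Rightarrow> nat \<Rightarrow> 'v \<Rightarrow> int set \<Rightarrow> 'v \<Rightarrow> int set \<Rightarrow> bool" where
  "neighbor_ivl G \<Delta> v I w J \<longleftrightarrow> J \<subseteq> I \<and>
     (\<exists>a b. J = {a..b} \<and> b - a \<ge> int \<Delta> \<and>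
       (\<forall>\<tau>\<in>{a..b - int \<Delta>}. \<exists>t\<in>{\<tau>..\<tau> + int \<Delta>}. ({v, w}, t) \<in> tedges G))"

definition neighborhood :: "'v tgraph \<Rightarrow> nat \<Rightarrow> 'v \<Rightarrow> int set \<Rightarrow> ('v \<times> int set) set" where
  "neighborhood G \<Delta> v I = {(w, J). w \<in> verts G \<and> neighbor_ivl G \<Delta> v I w J \<and>
     \<not> (\<exists>J'. neighbor_ivl G \<Delta> v I w J' \<and> J \<subset> J')}"

definition delta_cut :: "nat \<Rightarrow> ('v \<times> int set) set \<Rightarrow> ('v \<times> int set) set \<Rightarrow> ('v \<times> int set) set" where
  "delta_cut \<Delta> Y Z = {(v, I \<inter> I') | v I I'. (v, I) \<in> Y \<and> (v, I') \<in> Z \<and> ivl_length_ge \<Delta> (I \<inter> I')}"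

(* Big-step semantics of the nondeterministic procedure (the order in which the loop picks
   elements of P is unspecified).  BronKerboschDelta G \<Delta> P R X S: some run on input (P, R, X)
   terminates and adds exactly the elements of S to the solution.
   BKLoop describes the for-each loop from a state with current sets P and X. *)
inductive BronKerboschDelta ::
    "'v tgraph \<Rightarrow> nat \<Rightarrow> ('v \<times> int set) set \<Rightarrow> 'v set \<times> int set \<Rightarrow> ('v \<times> int set) set
      \<Rightarrow> ('v set \<times> int set) set \<Rightarrow> bool"
  and BKLoop ::
    "'v tgraph \<Rightarrow> nat \<Rightarrow> ('v \<times> int set) set \<Rightarrow> 'v set \<times> int set \<Rightarrow> ('v \<times> int set) set
      \<Rightarrow> ('v set \<times> int set) set \<Rightarrow> bool"
  for G :: "'v tgraph" and \<Delta> :: nat where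
  call: "BKLoop G \<Delta> P (C, I) X S \<Longrightarrow>
    BronKerboschDelta G \<Delta> P (C, I) X
      ((if \<forall>(w, I')\<in>P \<union> X. I' \<subset> I then {(C, I)} else {}) \<union> S)"
| loop_done: "BKLoop G \<Delta> {} R X {}"
| loop_step: "(v, I') \<in> P \<Longrightarrow>
    BronKerboschDelta G \<Delta> (delta_cut \<Delta> P (neighborhood G \<Delta> v I')) (C \<union> {v}, I')
      (delta_cut \<Delta> X (neighborhood G \<Delta> v I')) S \<Longrightarrow>
    BKLoop G \<Delta> (P - {(v, I')}) (C, I) (X \<union> {(v, I')}) S' \<Longrightarrow>
    BKLoop G \<Delta> P (C, I) X (S \<union> S')"

(* BKTerminates: every run of the procedure terminates, whatever the iteration order. *)
inductive BKTerminates ::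
    "'v tgraph \<Rightarrow> nat \<Rightarrow> ('v \<times> int set) set \<Rightarrow> 'v set \<times> int set \<Rightarrow> ('v \<times> int set) set \<Rightarrow> bool"
  and BKLoopTerminates ::
    "'v tgraph \<Rightarrow> nat \<Rightarrow> ('v \<times> int set) set \<Rightarrow> 'v set \<times> int set \<Rightarrow> ('v \<times> int set) set \<Rightarrow> bool"
  for G :: "'v tgraph" and \<Delta> :: nat where
  "BKLoopTerminates G \<Delta> P (C, I) X \<Longrightarrow> BKTerminates G \<Delta> P (C, I) X"
| "(\<And>v I'. (v, I') \<in> P \<Longrightarrow>
      BKTerminates G \<Delta> (delta_cut \<Delta> P (neighborhood G \<Delta> v I')) (C \<union> {v}, I')
        (delta_cut \<Delta> X (neighborhood G \<Delta> v I'))) \<Longrightarrow>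
   (\<And>v I'. (v, I') \<in> P \<Longrightarrow> BKLoopTerminates G \<Delta> (P - {(v, I')}) (C, I) (X \<union> {(v, I')})) \<Longrightarrow>
   BKLoopTerminates G \<Delta> P (C, I) X"

end

(* The invariant of the recursion is that the interval I of R = (C, I) is time-maximal for C and
   that P and X partition the set of all (w, J) with w outside C, J inside I, and J time-maximal
   for C together with w.  It is preserved because two time-maximal intervals of one vertex set
   that share an interval of length \<Delta> coincide: the union of the two would again be admissible.
   A call then adds exactly the maximal cliques (D, K) with D above C, K inside I, and no (w, J)
   in X such that w is in D and K is inside J. *)
theory Submission
  imports Defs
begin

section \<open>Intervals all of whose \<Delta>-windows satisfy a condition\<close>

text \<open>The shape of \<open>delta_clique\<close> with the condition on a window start left
  abstract, so that the interval arithmetic is done once for an arbitrary predicate.\<close>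

definition run :: "nat \<Rightarrow> (int \<Rightarrow> bool) \<Rightarrow> int set \<Rightarrow> bool" where
  "run \<Delta> q J \<longleftrightarrow> (\<exists>a b. J = {a..b} \<and> b - a \<ge> int \<Delta> \<and> (\<forall>\<tau>\<in>{a..b - int \<Delta>}. q \<tau>))"

lemma run_long: "run \<Delta> q J \<Longrightarrow> ivl_length_ge \<Delta> J"
  by (auto simp: run_def ivl_length_ge_def)

text \<open>A window of length \<Delta> cannot begin before the common part \<open>L\<close> and
  also end after it, so each window of the union lies wholly in \<open>I\<close> or wholly in
  \<open>J\<close>.\<close>

lemma run_Un:
  assumes "run \<Delta> q I" "run \<Delta> q J" "ivl_length_ge \<Delta> L" "L \<subseteq> I" "L \<subseteq> J"
  shows "run \<Delta> q (I \<union> J)"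
proof -
  obtain a b where I: "I = {a..b}" "b - a \<ge> int \<Delta>" "\<forall>\<tau>\<in>{a..b - int \<Delta>}. q \<tau>"
    using assms by (auto simp: run_def)
  obtain c d where J: "J = {c..d}" "d - c \<ge> int \<Delta>" "\<forall>\<tau>\<in>{c..d - int \<Delta>}. q \<tau>"
    using assms by (auto simp: run_def)
  obtain e f where L: "L = {e..f}" "f - e \<ge> int \<Delta>"
    using assms by (auto simp: ivl_length_ge_def)
  have le: "a \<le> e" "f \<le> b" "c \<le> e" "f \<le> d"
    using assms(4,5) I J L by auto
  have "I \<union> J = {min a c..max b d}"
    using I J L le by auto
  moreover have "q \<tau>" if "\<tau> \<in> {min a c..max b d - int \<Delta>}" for \<tau>
  proof -
    \<comment> \<open>If \<tau> \<le> \<open>e\<close>, the window ends by \<open>f\<close>, so the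
      interval with the smaller left end contains it; otherwise the one with the larger right end
      does.\<close>
    have "\<tau> \<in> {a..b - int \<Delta>} \<or> \<tau> \<in> {c..d - int \<Delta>}"
      using that I(2) J(2) L(2) le by (auto simp: min_def max_def split: if_splits)
    then show ?thesis using I(3) J(3) by blast
  qed
  moreover have "max b d - min a c \<ge> int \<Delta>"
    using I(2) by linarith
  ultimately show ?thesis by (auto simp: run_def)
qed

lemma run_mono:
  assumes "run \<Delta> q J" "ivl_length_ge \<Delta> K" "K \<subseteq> J" "\<And>\<tau>. q \<tau> \<Longrightarrow> q' \<tau>"
  shows "run \<Delta> q' K"
proof -
  obtain a b where J: "J = {a..b}" "b - a \<ge> int \<Delta>" "\<forall>\<tau>\<in>{a..b - int \<Delta>}. q \<tau>"
    using assms by (auto simp: run_def)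
  obtain c d where K: "K = {c..d}" "d - c \<ge> int \<Delta>"
    using assms by (auto simp: ivl_length_ge_def)
  have "a \<le> c" "d \<le> b" using assms(3) J K by auto
  then have "\<forall>\<tau>\<in>{c..d - int \<Delta>}. q' \<tau>" using J(3) assms(4) by auto
  then show ?thesis using K unfolding run_def by blast
qed

text \<open>Both hypotheses bring their own endpoints for \<open>J\<close>; as \<open>J\<close> is
  nonempty, \<open>Icc_eq_Icc\<close> identifies them.\<close>

lemma run_conj: "run \<Delta> q J \<Longrightarrow> run \<Delta> q' J \<Longrightarrow> run \<Delta> (\<lambda>\<tau>. q \<tau> \<and> q' \<tau>) J"
  by (fastforce simp: run_def Icc_eq_Icc)

lemma long_Int:
  assumes "ivl_length_ge \<Delta> I" "ivl_length_ge \<Delta> J" "ivl_length_ge \<Delta> L" "L \<subseteq> I" "L \<subseteq> J"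
  shows "ivl_length_ge \<Delta> (I \<inter> J)"
proof -
  obtain a b c d e f where E: "I = {a..b}" "J = {c..d}" "L = {e..f}" "f - e \<ge> int \<Delta>"
    using assms by (auto simp: ivl_length_ge_def)
  have le: "a \<le> e" "f \<le> b" "c \<le> e" "f \<le> d"
    using assms(4,5) E by auto
  have "I \<inter> J = {max a c..min b d}" "min b d - max a c \<ge> int \<Delta>"
    using E le by auto
  then show ?thesis unfolding ivl_length_ge_def by blast
qed

lemma delta_cut_Un: "delta_cut \<Delta> (A \<union> B) Z = delta_cut \<Delta> A Z \<union> delta_cut \<Delta> B Z"
  by (auto simp: delta_cut_def)

section \<open>Cliques as runs, and neighborhoods as two-vertex cliques\<close>

definition linked :: "'v tgraph \<Rightarrow> nat \<Rightarrow> 'v set \<Rightarrow> int \<Rightarrow> bool" where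
  "linked G \<Delta> C \<tau> \<longleftrightarrow>
     (\<forall>v\<in>C. \<forall>w\<in>C. v \<noteq> w \<longrightarrow> (\<exists>t\<in>{\<tau>..\<tau> + int \<Delta>}. ({v, w}, t) \<in> tedges G))"

locale finite_temporal_graph =
  fixes G :: "'v tgraph" and \<Delta> :: nat
  assumes temporal: "temporal_graph G"
begin

abbreviation clique :: "'v set \<Rightarrow> int set \<Rightarrow> bool" where
  "clique C I \<equiv> delta_clique G \<Delta> (C, I)"

lemma finite_verts: "finite (verts G)"
  using temporal by (simp add: temporal_graph_def)

lemma finite_lifetime: "finite (lifetime G)"
  using temporal by (auto simp: temporal_graph_def)

lemma clique_iff_run:
  "clique C I \<longleftrightarrow> C \<subseteq> verts G \<and> I \<subseteq> lifetime G \<and> run \<Delta> (linked G \<Delta> C) I"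
  by (auto simp: delta_clique_def run_def linked_def)

lemma clique_long: "clique C I \<Longrightarrow> ivl_length_ge \<Delta> I"
  by (auto simp: clique_iff_run dest: run_long)

lemma clique_subset: "clique C I \<Longrightarrow> C \<subseteq> verts G \<and> I \<subseteq> lifetime G"
  by (auto simp: clique_iff_run)

lemma clique_Un:
  "clique C I \<Longrightarrow> clique C J \<Longrightarrow> ivl_length_ge \<Delta> L \<Longrightarrow> L \<subseteq> I \<Longrightarrow> L \<subseteq> J \<Longrightarrow> clique C (I \<union> J)"
  by (auto simp: clique_iff_run intro: run_Un)

lemma linked_mono: "linked G \<Delta> C \<tau> \<Longrightarrow> D \<subseteq> C \<Longrightarrow> linked G \<Delta> D \<tau>"
  by (auto simp: linked_def)

lemma clique_mono:
  assumes "clique C I" "D \<subseteq> C" "J \<subseteq> I" "ivl_length_ge \<Delta> J"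
  shows "clique D J"
proof -
  have "run \<Delta> (linked G \<Delta> D) J"
    using assms linked_mono[OF _ assms(2)] by (auto simp: clique_iff_run intro: run_mono)
  then show ?thesis using assms by (auto simp: clique_iff_run)
qed

lemma clique_mono_verts: "clique C I \<Longrightarrow> D \<subseteq> C \<Longrightarrow> clique D I"
  using clique_mono clique_long by blast

text \<open>Any two distinct vertices of the large set lie together in one of the three smaller
  sets.\<close>

lemma clique_insert_insert:
  assumes "clique (insert v C) I" "clique (insert w C) I" "clique {v, w} I"
  shows "clique (insert w (insert v C)) I"
proof -
  have "run \<Delta> (\<lambda>\<tau>. linked G \<Delta> (insert v C) \<tau> \<and> linked G \<Delta> (insert w C) \<tau> \<and> linked G \<Delta> {v, w} \<tau>) I"
    using assms by (intro run_conj) (auto simp: clique_iff_run)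
  then have "run \<Delta> (linked G \<Delta> (insert w (insert v C))) I"
    by (rule run_mono[OF _ clique_long[OF assms(1)]]) (auto simp: linked_def)
  then show ?thesis using assms by (auto simp: clique_iff_run)
qed

text \<open>Translates neighborhoods into cliques. The conjunct \<open>v \<noteq> w\<close> is
  essential: for equal vertices the clique condition is vacuous, whereas \<open>neighbor_ivl\<close>
  would ask for a loop.\<close>

lemma neighbor_ivl_iff_clique:
  assumes "v \<in> verts G" "w \<in> verts G" "I \<subseteq> lifetime G"
  shows "neighbor_ivl G \<Delta> v I w J \<longleftrightarrow> v \<noteq> w \<and> J \<subseteq> I \<and> clique {v, w} J"
proof (cases "v = w")
  case True
  have loopfree: "({w, w}, t) \<notin> tedges G" for t
    using temporal by (auto simp: temporal_graph_def)
  \<comment> \<open>At least one window exists, so a loop would really be demanded.\<close>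
  have "a \<in> {a..b - int \<Delta>}" if "int \<Delta> \<le> b - a" for a b :: int
    using that by simp
  then have "\<not> neighbor_ivl G \<Delta> w I w J"
    unfolding neighbor_ivl_def using loopfree by blast
  then show ?thesis using True by simp
next
  case False
  have sym: "{w, v} = {v, w}" by auto
  show ?thesis
    using False assms by (auto simp: neighbor_ivl_def delta_clique_def sym)
qed

section \<open>Time-maximal cliques\<close>

text \<open>Clique intervals lie in the finite lifetime, so only finitely many compete. The bound
  \<open>I\<close> serves both kinds of maximality: inside a given interval for neighborhoods, and
  \<open>UNIV\<close> for \<open>tmax\<close>.\<close>

lemma extend_to_maximal:
  assumes "clique C J" "J \<subseteq> I"
  obtains K where "clique C K" "J \<subseteq> K" "K \<subseteq> I" "\<forall>L. clique C L \<longrightarrow> L \<subseteq> I \<longrightarrow> K \<subseteq> L \<longrightarrow> L = K"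
proof -
  let ?A = "{K. clique C K \<and> K \<subseteq> I}"
  have "?A \<subseteq> Pow (lifetime G)" by (auto dest: clique_subset)
  then have "finite ?A" using finite_lifetime finite_subset by blast
  then obtain K where "K \<in> ?A" "J \<subseteq> K" "\<forall>L\<in>?A. K \<subseteq> L \<longrightarrow> K = L"
    using finite_has_maximal2[of ?A J] assms by auto
  then show ?thesis by (intro that[of K]) auto
qed

text \<open>Only intervals over the same vertex set compete. For cliques this agrees with
  \<open>time_maximal\<close>, since a clique on a superset of \<open>C\<close> is also one on
  \<open>C\<close>.\<close>

definition tmax :: "'v set \<Rightarrow> int set \<Rightarrow> bool" where
  "tmax C I \<longleftrightarrow> clique C I \<and> (\<forall>J. clique C J \<longrightarrow> I \<subseteq> J \<longrightarrow> J = I)"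

lemma tmax_clique: "tmax C I \<Longrightarrow> clique C I"
  by (simp add: tmax_def)

lemma tmax_absorb:
  assumes "tmax C I" "clique C J" "ivl_length_ge \<Delta> L" "L \<subseteq> I" "L \<subseteq> J"
  shows "J \<subseteq> I"
proof -
  have "clique C (I \<union> J)" using assms clique_Un by (auto simp: tmax_def)
  then show ?thesis using assms(1) by (auto simp: tmax_def)
qed

lemma tmax_unique:
  assumes "tmax C I" "tmax C J" "ivl_length_ge \<Delta> L" "L \<subseteq> I" "L \<subseteq> J"
  shows "I = J"
  using tmax_absorb[of C I J L] tmax_absorb[of C J I L] assms by (auto simp: tmax_def)

text \<open>Vertex-maximality needs testing only for one extra vertex on the same interval, which is
  the form that the test of the procedure can see: a larger clique shrinks to
  \<open>insert w C\<close> on \<open>I\<close>.\<close>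

lemma maximal_iff:
  "maximal_delta_clique G \<Delta> (C, I) \<longleftrightarrow> tmax C I \<and> (\<forall>w. w \<notin> C \<longrightarrow> \<not> tmax (insert w C) I)"
proof
  assume M: "maximal_delta_clique G \<Delta> (C, I)"
  then have "tmax C I"
    by (auto simp: maximal_delta_clique_def time_maximal_def tmax_def)
  moreover have "\<not> clique (insert w C) I" if "w \<notin> C" for w
    using M that by (auto simp: maximal_delta_clique_def vertex_maximal_def)
  ultimately show "tmax C I \<and> (\<forall>w. w \<notin> C \<longrightarrow> \<not> tmax (insert w C) I)"
    by (auto simp: tmax_def)
next
  assume R: "tmax C I \<and> (\<forall>w. w \<notin> C \<longrightarrow> \<not> tmax (insert w C) I)"
  then have c: "clique C I" by (simp add: tmax_def)
  have "False" if "clique C' I'" "I \<subseteq> I'" "C \<subset> C'" for C' I'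
  proof -
    obtain w where w: "w \<in> C'" "w \<notin> C" using \<open>C \<subset> C'\<close> by blast
    have "clique (insert w C) I"
      using clique_mono[OF that(1)] w that clique_long[OF c] by auto
    \<comment> \<open>A longer interval for \<open>insert w C\<close> would also be one for
      \<open>C\<close>, against time-maximality of \<open>I\<close>.\<close>
    moreover have "J = I" if "clique (insert w C) J" "I \<subseteq> J" for J
      using R that clique_mono_verts[OF that(1), of C] by (auto simp: tmax_def)
    ultimately have "tmax (insert w C) I" by (auto simp: tmax_def)
    then show False using R w by blast
  qed
  moreover have "False" if "clique C' I'" "I \<subset> I'" "C \<subseteq> C'" for C' I'
    using R clique_mono_verts[OF that(1,3)] that by (auto simp: tmax_def)
  ultimately show "maximal_delta_clique G \<Delta> (C, I)"
    using c by (auto simp: maximal_delta_clique_def vertex_maximal_def time_maximal_def)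
qed

section \<open>One-vertex extensions and the \<Delta>-cut\<close>

text \<open>The value of \<open>P \<union> X\<close> in a call with \<open>R = (C, I)\<close>.
  Maximality of \<open>J\<close> is among all intervals, not merely those inside
  \<open>I\<close>.\<close>

definition exts :: "'v set \<Rightarrow> int set \<Rightarrow> ('v \<times> int set) set" where
  "exts C I = {(w, J). w \<notin> C \<and> J \<subseteq> I \<and> tmax (insert w C) J}"

lemma finite_exts: "finite (exts C I)"
proof -
  have "exts C I \<subseteq> verts G \<times> Pow (lifetime G)"
    by (auto simp: exts_def tmax_def dest: clique_subset)
  then show ?thesis
    using finite_verts finite_lifetime finite_subset by blast
qed

lemma exts_cover:
  assumes "tmax C I" "clique D K" "C \<subseteq> D" "K \<subseteq> I" "w \<in> D" "w \<notin> C"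
  obtains J where "(w, J) \<in> exts C I" "K \<subseteq> J"
proof -
  have long: "ivl_length_ge \<Delta> K" using assms clique_long by blast
  have "clique (insert w C) K" using assms clique_mono_verts[of D K] by auto
  from extend_to_maximal[OF this subset_UNIV] obtain J
    where J: "clique (insert w C) J" "K \<subseteq> J" "J \<subseteq> UNIV"
      "\<forall>L. clique (insert w C) L \<longrightarrow> L \<subseteq> UNIV \<longrightarrow> J \<subseteq> L \<longrightarrow> L = J" .
  \<comment> \<open>\<open>J\<close> was extended without a bound; it stays inside \<open>I\<close>
    because \<open>I\<close> absorbs every clique interval of \<open>C\<close> that shares
    \<open>K\<close> with it.\<close>
  have "J \<subseteq> I"
    using tmax_absorb[OF assms(1) clique_mono_verts[OF J(1)] long] assms J by auto
  then have "(w, J) \<in> exts C I" using J assms by (auto simp: exts_def tmax_def)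
  then show ?thesis using that J(2) by blast
qed

lemma neighborhood_cover:
  assumes "clique D K" "v \<in> D" "w \<in> D" "v \<noteq> w" "K \<subseteq> I" "I \<subseteq> lifetime G"
  obtains J where "(w, J) \<in> neighborhood G \<Delta> v I" "K \<subseteq> J"
proof -
  have V: "v \<in> verts G" "w \<in> verts G" using assms clique_subset[of D K] by auto
  have "clique {v, w} K" using assms clique_mono_verts[of D K] by auto
  from extend_to_maximal[OF this assms(5)] obtain J
    where J: "clique {v, w} J" "K \<subseteq> J" "J \<subseteq> I"
      "\<forall>L. clique {v, w} L \<longrightarrow> L \<subseteq> I \<longrightarrow> J \<subseteq> L \<longrightarrow> L = J" .
  have "(w, J) \<in> neighborhood G \<Delta> v I"
    using V J assms by (auto simp: neighborhood_def neighbor_ivl_iff_clique[OF V assms(6)])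
  then show ?thesis using that J(2) by blast
qed

lemma neighborhoodD:
  assumes "(w, J) \<in> neighborhood G \<Delta> v I" "v \<in> verts G" "I \<subseteq> lifetime G"
  shows "w \<noteq> v" "J \<subseteq> I" "clique {v, w} J" "\<And>L. clique {v, w} L \<Longrightarrow> L \<subseteq> I \<Longrightarrow> J \<subseteq> L \<Longrightarrow> L = J"
proof -
  have w: "w \<in> verts G" using assms by (auto simp: neighborhood_def)
  show "w \<noteq> v" "J \<subseteq> I" "clique {v, w} J" "\<And>L. clique {v, w} L \<Longrightarrow> L \<subseteq> I \<Longrightarrow> J \<subseteq> L \<Longrightarrow> L = J"
    using assms(1) by (auto simp: neighborhood_def neighbor_ivl_iff_clique[OF assms(2) w assms(3)])
qed

text \<open>A competing interval \<open>L\<close> for \<open>C\<close> with both \<open>v\<close>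
  and \<open>w\<close> is absorbed by \<open>J\<close> and by \<open>I'\<close>, and maximality of
  \<open>J'\<close> inside \<open>I'\<close> then absorbs it into \<open>J'\<close>.\<close>

lemma exts_Int_neighborhood:
  assumes v: "(v, I') \<in> exts C I" and w: "(w, J) \<in> exts C I"
    and nb: "(w, J') \<in> neighborhood G \<Delta> v I'" and long: "ivl_length_ge \<Delta> (J \<inter> J')"
  shows "(w, J \<inter> J') \<in> exts (insert v C) I'"
proof -
  have vm: "tmax (insert v C) I'" and wm: "tmax (insert w C) J" and wC: "w \<notin> C"
    using v w by (auto simp: exts_def)
  have "v \<in> verts G" "I' \<subseteq> lifetime G" using clique_subset[OF tmax_clique[OF vm]] by auto
  note nb = neighborhoodD[OF nb this]
  have K: "clique (insert w (insert v C)) (J \<inter> J')"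
  proof (rule clique_insert_insert)
    show "clique (insert v C) (J \<inter> J')"
      using clique_mono[OF tmax_clique[OF vm] _ _ long] nb(2) by auto
    show "clique (insert w C) (J \<inter> J')"
      using clique_mono[OF tmax_clique[OF wm] _ _ long] by auto
    show "clique {v, w} (J \<inter> J')"
      using clique_mono[OF nb(3) _ _ long] by auto
  qed
  have "L = J \<inter> J'" if L: "clique (insert w (insert v C)) L" "J \<inter> J' \<subseteq> L" for L
  proof -
    have "L \<subseteq> J"
      using tmax_absorb[OF wm clique_mono_verts[OF L(1)] long] L by auto
    moreover have "L \<subseteq> I'"
      using tmax_absorb[OF vm clique_mono_verts[OF L(1)] long] L nb by auto
    \<comment> \<open>The union still lies in \<open>I'\<close>, so maximality of \<open>J'\<close>
      applies to it and gives \<open>L \<subseteq> J'\<close>.\<close>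
    moreover have "clique {v, w} (J' \<union> L)"
      using clique_Un[OF nb(3) clique_mono_verts[OF L(1)] long] L by auto
    ultimately show ?thesis using nb(4)[of "J' \<union> L"] nb(2) L(2) by auto
  qed
  then show ?thesis using K nb wC by (auto simp: exts_def tmax_def)
qed

text \<open>The reason the recursion works: cutting the candidates for \<open>C\<close> with the
  neighborhood of \<open>v\<close> yields exactly the candidates for
  \<open>insert v C\<close>.\<close>

lemma delta_cut_exts:
  assumes I: "tmax C I" and v: "(v, I') \<in> exts C I"
  shows "delta_cut \<Delta> (exts C I) (neighborhood G \<Delta> v I') = exts (insert v C) I'"
proof (intro equalityI subsetI)
  fix x assume "x \<in> delta_cut \<Delta> (exts C I) (neighborhood G \<Delta> v I')"
  then show "x \<in> exts (insert v C) I'"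
    using exts_Int_neighborhood[OF v] by (auto simp: delta_cut_def)
next
  fix x assume x: "x \<in> exts (insert v C) I'"
  obtain w L where wL: "x = (w, L)" by force
  have L: "w \<notin> C" "w \<noteq> v" "L \<subseteq> I'" "tmax (insert w (insert v C)) L"
    using x wL by (auto simp: exts_def)
  have vI: "I' \<subseteq> I" "tmax (insert v C) I'" using v by (auto simp: exts_def)
  note cL = tmax_clique[OF L(4)]
  have LI: "L \<subseteq> I" using L(3) vI(1) by auto
  obtain J where J: "(w, J) \<in> exts C I" "L \<subseteq> J"
    using exts_cover[OF I cL _ LI, of w] L by auto
  have I'T: "I' \<subseteq> lifetime G" using clique_subset[OF tmax_clique[OF vI(2)]] by auto
  obtain J' where J': "(w, J') \<in> neighborhood G \<Delta> v I'" "L \<subseteq> J'"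
    using neighborhood_cover[OF cL _ _ _ L(3) I'T, of v w] L by auto
  have "v \<in> verts G" using clique_subset[OF cL] by auto
  note nb = neighborhoodD[OF J'(1) this I'T]
  have long: "ivl_length_ge \<Delta> (J \<inter> J')"
    using long_Int[OF _ clique_long[OF nb(3)] clique_long[OF cL] J(2) J'(2)] J(1)
    by (auto simp: exts_def dest: tmax_clique clique_long)
  \<comment> \<open>The cut interval is itself a clique interval containing \<open>L\<close>, so
    maximality of \<open>L\<close> forces equality.\<close>
  have "(w, J \<inter> J') \<in> exts (insert v C) I'"
    by (rule exts_Int_neighborhood[OF v J(1) J'(1) long])
  then have "J \<inter> J' = L"
    using L(4) J(2) J'(2) by (auto simp: exts_def tmax_def)
  then show "x \<in> delta_cut \<Delta> (exts C I) (neighborhood G \<Delta> v I')"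
    using wL J(1) J'(1) long unfolding delta_cut_def by blast
qed

section \<open>The invariant of the recursion\<close>

definition invariant :: "('v \<times> int set) set \<Rightarrow> 'v set \<times> int set \<Rightarrow> ('v \<times> int set) set \<Rightarrow> bool" where
  "invariant P R X \<longleftrightarrow> tmax (fst R) (snd R) \<and> P \<union> X = exts (fst R) (snd R) \<and> P \<inter> X = {}"

lemma invariant_loop: "invariant P R X \<Longrightarrow> x \<in> P \<Longrightarrow> invariant (P - {x}) R (X \<union> {x})"
  by (auto simp: invariant_def)

lemma invariant_call:
  assumes inv: "invariant P (C, I) X" and v: "(v, I') \<in> P"
  shows "invariant (delta_cut \<Delta> P (neighborhood G \<Delta> v I')) (C \<union> {v}, I')
    (delta_cut \<Delta> X (neighborhood G \<Delta> v I'))"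
proof -
  have I: "tmax C I" and PX: "P \<union> X = exts C I" and disj: "P \<inter> X = {}"
    using inv by (auto simp: invariant_def)
  have v': "(v, I') \<in> exts C I" using v PX by auto
  have "delta_cut \<Delta> P (neighborhood G \<Delta> v I') \<inter> delta_cut \<Delta> X (neighborhood G \<Delta> v I') = {}"
  proof -
    have False if w: "(w, J) \<in> P" "(w, K) \<in> X" "J \<inter> J' = K \<inter> K'" "ivl_length_ge \<Delta> (J \<inter> J')"
      for w J J' K K'
    proof -
      \<comment> \<open>An interval common to both cuts has length at least \<Delta> and lies in
        \<open>J\<close> and in \<open>K\<close>, so these two time-maximal intervals
        coincide.\<close>
      have "tmax (insert w C) J" "tmax (insert w C) K"
        using PX w by (auto simp: exts_def)
      from tmax_unique[OF this w(4)] have "J = K" using w(3) by auto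
      then show False using w disj by auto
    qed
    then show ?thesis unfolding delta_cut_def by fastforce
  qed
  then show ?thesis
    using v' delta_cut_exts[OF I v'] PX by (auto simp: invariant_def exts_def simp flip: delta_cut_Un)
qed

section \<open>The cliques added by a call and by its loop\<close>

definition found :: "'v set \<times> int set \<Rightarrow> ('v \<times> int set) set \<Rightarrow> ('v set \<times> int set) set" where
  "found R X = {(D, K). maximal_delta_clique G \<Delta> (D, K) \<and> fst R \<subseteq> D \<and> K \<subseteq> snd R \<and>
     (\<forall>(w, J)\<in>X. \<not> (w \<in> D \<and> K \<subseteq> J))}"

text \<open>A clique on the vertex set of \<open>R\<close> itself can only come from the test before
  the loop.\<close>

definition found_loop :: "'v set \<times> int set \<Rightarrow> ('v \<times> int set) set \<Rightarrow> ('v set \<times> int set) set" where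
  "found_loop R X = {(D, K) \<in> found R X. D \<noteq> fst R}"

lemma maximal_clique: "maximal_delta_clique G \<Delta> (D, K) \<Longrightarrow> clique D K"
  by (simp add: maximal_delta_clique_def)

lemma found_call:
  assumes "invariant P (C, I) X"
  shows "found (C, I) X =
    (if \<forall>(w, I')\<in>P \<union> X. I' \<subset> I then {(C, I)} else {}) \<union> found_loop (C, I) X"
proof -
  have I: "tmax C I" and PX: "P \<union> X = exts C I"
    using assms by (auto simp: invariant_def)
  \<comment> \<open>The test fails exactly when some candidate has the full interval
    \<open>I\<close>, which is the obstruction in \<open>maximal_iff\<close>.\<close>
  have test: "(\<forall>(w, I')\<in>P \<union> X. I' \<subset> I) \<longleftrightarrow> maximal_delta_clique G \<Delta> (C, I)"
    using I unfolding PX maximal_iff by (auto simp: exts_def)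
  have root: "(C, K) \<in> found (C, I) X \<longleftrightarrow> K = I \<and> maximal_delta_clique G \<Delta> (C, I)" for K
  proof
    assume K: "(C, K) \<in> found (C, I) X"
    then have "tmax C K" "K \<subseteq> I" by (auto simp: found_def maximal_iff)
    then have "K = I" using I by (auto simp: tmax_def)
    then show "K = I \<and> maximal_delta_clique G \<Delta> (C, I)" using K by (auto simp: found_def)
  next
    assume K: "K = I \<and> maximal_delta_clique G \<Delta> (C, I)"
    have "w \<notin> C" if "(w, J) \<in> X" for w J
      using that PX by (auto simp: exts_def)
    then show "(C, K) \<in> found (C, I) X" using K by (auto simp: found_def)
  qed
  show ?thesis unfolding test
    using root by (auto simp: found_loop_def)
qed

text \<open>With \<open>P\<close> empty, \<open>X\<close> holds every candidate, and by
  \<open>exts_cover\<close> some candidate excludes any clique that properly extends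
  \<open>fst R\<close>.\<close>

lemma found_loop_done:
  assumes "invariant {} R X"
  shows "found_loop R X = {}"
proof -
  have False if "(D, K) \<in> found_loop R X" for D K
  proof -
    have DK: "maximal_delta_clique G \<Delta> (D, K)" "fst R \<subseteq> D" "K \<subseteq> snd R" "D \<noteq> fst R"
      "\<forall>(w, J)\<in>X. \<not> (w \<in> D \<and> K \<subseteq> J)"
      using that by (auto simp: found_loop_def found_def)
    obtain w where w: "w \<in> D" "w \<notin> fst R" using DK by auto
    have R: "tmax (fst R) (snd R)" "X = exts (fst R) (snd R)"
      using assms by (auto simp: invariant_def)
    obtain J where "(w, J) \<in> exts (fst R) (snd R)" "K \<subseteq> J"
      using exts_cover[OF R(1) maximal_clique[OF DK(1)] DK(2,3) w] .
    then show False using R(2) DK(5) w by auto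
  qed
  then show ?thesis by auto
qed

text \<open>Cliques that contain \<open>v\<close> and have their interval inside \<open>I'\<close>
  go to the recursive call; all others remain for the rest of the loop. The main point is that the
  cut of \<open>X\<close> excludes as much in the recursive call as \<open>X\<close> itself
  does.\<close>

lemma found_loop_step:
  assumes inv: "invariant P (C, I) X" and v: "(v, I') \<in> P"
  shows "found_loop (C, I) X =
    found (C \<union> {v}, I') (delta_cut \<Delta> X (neighborhood G \<Delta> v I')) \<union>
    found_loop (C, I) (X \<union> {(v, I')})" (is "_ = ?A \<union> ?B")
proof -
  have PX: "P \<union> X = exts C I" and disj: "P \<inter> X = {}"
    using inv by (auto simp: invariant_def)
  have vI: "v \<notin> C" "I' \<subseteq> I" "tmax (insert v C) I'"
    using v PX by (auto simp: exts_def)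
  have I'T: "I' \<subseteq> lifetime G" "v \<in> verts G"
    using clique_subset[OF tmax_clique[OF vI(3)]] by auto
  have "DK \<in> ?A \<union> ?B" if "DK \<in> found_loop (C, I) X" for DK
  proof -
    obtain D K where DK: "DK = (D, K)" by force
    show ?thesis
      using that unfolding DK
      \<comment> \<open>Cutting only shrinks intervals, so a clique not excluded by \<open>X\<close>
        is not excluded by the cut either.\<close>
      by (cases "v \<in> D \<and> K \<subseteq> I'") (auto simp: found_loop_def found_def delta_cut_def)
  qed
  moreover have "?B \<subseteq> found_loop (C, I) X"
    by (auto simp: found_loop_def found_def)
  moreover have "DK \<in> found_loop (C, I) X" if "DK \<in> ?A" for DK
  proof -
    obtain D K where DKeq: "DK = (D, K)" by force
    have DK: "maximal_delta_clique G \<Delta> (D, K)" "C \<subseteq> D" "v \<in> D" "K \<subseteq> I'"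
      and nX: "\<And>w J. (w, J) \<in> delta_cut \<Delta> X (neighborhood G \<Delta> v I') \<Longrightarrow> w \<in> D \<Longrightarrow> \<not> K \<subseteq> J"
      using that by (auto simp: DKeq found_def)
    note cK = maximal_clique[OF DK(1)]
    \<comment> \<open>An entry of \<open>X\<close> excluding the clique would leave a trace in the
      cut: some neighborhood interval \<open>J'\<close> also contains \<open>K\<close>, and
      \<open>J \<inter> J'\<close> would exclude the clique there.\<close>
    have False if w: "(w, J) \<in> X" "w \<in> D" "K \<subseteq> J" for w J
    proof -
      have wm: "tmax (insert w C) J" using PX w by (auto simp: exts_def)
      have "w \<noteq> v"
      proof
        assume "w = v"
        \<comment> \<open>Two time-maximal intervals sharing \<open>K\<close> coincide, so the same
          pair would be in both \<open>P\<close> and \<open>X\<close>.\<close>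
        then have "J = I'" using tmax_unique[OF _ vI(3) clique_long[OF cK] w(3) DK(4)] wm by simp
        then show False using \<open>w = v\<close> w(1) v disj by auto
      qed
      then obtain J' where J': "(w, J') \<in> neighborhood G \<Delta> v I'" "K \<subseteq> J'"
        using neighborhood_cover[OF cK DK(3) w(2) _ DK(4) I'T(1)] by metis
      have "ivl_length_ge \<Delta> (J \<inter> J')"
        using long_Int[OF clique_long[OF tmax_clique[OF wm]] _ clique_long[OF cK] w(3) J'(2)]
          clique_long[OF neighborhoodD(3)[OF J'(1) I'T(2,1)]] by blast
      then have "(w, J \<inter> J') \<in> delta_cut \<Delta> X (neighborhood G \<Delta> v I')"
        using w(1) J'(1) unfolding delta_cut_def by blast
      then show False using nX w J'(2) by blast
    qed
    then show ?thesis
      using DK vI by (auto simp: DKeq found_loop_def found_def)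
  qed
  ultimately show ?thesis by blast
qed

section \<open>Results and termination of runs\<close>

text \<open>The order of iteration cannot matter, because the claimed output depends on
  \<open>R\<close> and \<open>X\<close> only.\<close>

lemma run_result:
  "BronKerboschDelta G \<Delta> P R X S \<Longrightarrow> invariant P R X \<longrightarrow> S = found R X"
  "BKLoop G \<Delta> P R X S \<Longrightarrow> invariant P R X \<longrightarrow> S = found_loop R X"
proof (induction rule: BronKerboschDelta_BKLoop.inducts)
  case (call P C I X S)
  then show ?case using found_call by blast
next
  case (loop_done R X)
  then show ?case using found_loop_done by blast
next
  case (loop_step v I' P C X S I S')
  then show ?case using found_loop_step invariant_call invariant_loop by metis
qed

text \<open>The last assumption is the induction hypothesis on the vertex set, passed in so that the
  induction on \<open>P\<close> stands alone. Existence of a result is carried along, because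
  termination of all runs does not itself exhibit an output \<open>S\<close>.\<close>

lemma loop_halts:
  assumes "finite P" "invariant P (C, I) X"
    and "\<And>P X v I'. invariant P (C \<union> {v}, I') X \<Longrightarrow> v \<notin> C \<Longrightarrow>
      BKTerminates G \<Delta> P (C \<union> {v}, I') X \<and> (\<exists>S. BronKerboschDelta G \<Delta> P (C \<union> {v}, I') X S)"
  shows "BKLoopTerminates G \<Delta> P (C, I) X \<and> (\<exists>S. BKLoop G \<Delta> P (C, I) X S)"
  using assms(1,2)
proof (induction P arbitrary: X rule: finite_remove_induct)
  case empty
  then show ?case
    by (auto intro: BKTerminates_BKLoopTerminates.intros BronKerboschDelta_BKLoop.intros)
next
  case (remove P)
  have rec: "BKTerminates G \<Delta> (delta_cut \<Delta> P (neighborhood G \<Delta> v I')) (C \<union> {v}, I')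
        (delta_cut \<Delta> X (neighborhood G \<Delta> v I')) \<and>
      (\<exists>S. BronKerboschDelta G \<Delta> (delta_cut \<Delta> P (neighborhood G \<Delta> v I')) (C \<union> {v}, I')
        (delta_cut \<Delta> X (neighborhood G \<Delta> v I')) S)" if "(v, I') \<in> P" for v I'
    using assms(3)[OF invariant_call[OF remove.prems that]] that remove.prems
    by (auto simp: invariant_def exts_def)
  have rest: "BKLoopTerminates G \<Delta> (P - {x}) (C, I) (X \<union> {x}) \<and>
      (\<exists>S. BKLoop G \<Delta> (P - {x}) (C, I) (X \<union> {x}) S)" if "x \<in> P" for x
    using remove.IH[OF that invariant_loop[OF remove.prems that]] .
  \<comment> \<open>Any one choice gives a run; termination below has to treat every choice.\<close>
  obtain v I' where v: "(v, I') \<in> P" using remove.hyps by fastforce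
  have "\<exists>S. BKLoop G \<Delta> P (C, I) X S"
    using rec[OF v] rest[OF v] BronKerboschDelta_BKLoop.loop_step[OF v] by blast
  moreover have "BKLoopTerminates G \<Delta> P (C, I) X"
    by (rule BKTerminates_BKLoopTerminates.intros(2)) (use rec rest in blast)+
  ultimately show ?case by blast
qed

text \<open>Each recursive call adds to \<open>C\<close> a new vertex of the graph, so fewer
  vertices remain outside.\<close>

lemma halts:
  "invariant P (C, I) X \<Longrightarrow>
    BKTerminates G \<Delta> P (C, I) X \<and> (\<exists>S. BronKerboschDelta G \<Delta> P (C, I) X S)"
proof (induction "card (verts G - C)" arbitrary: P C I X rule: less_induct)
  case less
  have rec: "BKTerminates G \<Delta> P' (C \<union> {v}, I') X' \<and>
      (\<exists>S. BronKerboschDelta G \<Delta> P' (C \<union> {v}, I') X' S)"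
    if "invariant P' (C \<union> {v}, I') X'" "v \<notin> C" for P' X' v I'
  proof -
    have "v \<in> verts G" using that by (auto simp: invariant_def dest!: tmax_clique clique_subset)
    then have "card (verts G - (C \<union> {v})) < card (verts G - C)"
      using that(2) finite_verts by (intro psubset_card_mono) auto
    then show ?thesis using less.hyps that(1) by blast
  qed
  have "finite P"
    using less.prems finite_exts[of C I] by (auto simp: invariant_def intro: finite_subset)
  from loop_halts[OF this less.prems rec] show ?case
    by (blast intro: BKTerminates_BKLoopTerminates.intros BronKerboschDelta_BKLoop.intros)
qed

section \<open>The initial call\<close>

text \<open>With at most one vertex the clique condition is vacuous, so the whole lifetime, being
  long enough, is the only time-maximal interval.\<close>

lemma invariant_initial:
  assumes "ivl_length_ge \<Delta> (lifetime G)"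
  shows "invariant (verts G \<times> {lifetime G}) ({}, lifetime G) {}"
proof -
  \<comment> \<open>The form \<open>C \<subseteq> {w}\<close> treats the empty set and singletons at
    once.\<close>
  have c: "clique C (lifetime G)" if "C \<subseteq> {w}" "C \<subseteq> verts G" for C w
  proof -
    have "v = v'" if "v \<in> C" "v' \<in> C" for v v'
      using \<open>C \<subseteq> {w}\<close> that by blast
    then show ?thesis
      using assms \<open>C \<subseteq> verts G\<close> by (auto simp: delta_clique_def ivl_length_ge_def)
  qed
  then have t: "tmax C (lifetime G)" if "C \<subseteq> {w}" "C \<subseteq> verts G" for C w
    using c[OF that] by (auto simp: tmax_def dest: clique_subset)
  have "tmax {w} J \<longleftrightarrow> w \<in> verts G \<and> J = lifetime G" for w J
  proof
    assume J: "tmax {w} J"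
    then have "w \<in> verts G" "J \<subseteq> lifetime G" by (auto dest!: tmax_clique clique_subset)
    then show "w \<in> verts G \<and> J = lifetime G"
      using J c[of "{w}" w] by (auto simp: tmax_def)
  qed (use t[of "{w}" w] in auto)
  then show ?thesis using t[of "{}"] by (auto simp: invariant_def exts_def)
qed

lemma found_initial: "found ({}, lifetime G) {} = {R. maximal_delta_clique G \<Delta> R}"
  by (auto simp: found_def dest: maximal_clique clique_subset)

end

theorem theorem1:
  fixes G :: "'v tgraph" and \<Delta> :: nat
  assumes "temporal_graph G"
    and "ivl_length_ge \<Delta> (lifetime G)"
  shows "BKTerminates G \<Delta> (verts G \<times> {lifetime G}) ({}, lifetime G) {} \<and>
    (\<forall>S. BronKerboschDelta G \<Delta> (verts G \<times> {lifetime G}) ({}, lifetime G) {} S \<longleftrightarrow>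
         S = {R. maximal_delta_clique G \<Delta> R})"
proof -
  interpret finite_temporal_graph G \<Delta> by unfold_locales (rule assms(1))
  note start = invariant_initial[OF assms(2)]
  show ?thesis
    \<comment> \<open>\<open>run_result\<close> makes every output equal to the set of maximal
      cliques; the converse needs the run that \<open>halts\<close> provides.\<close>
    using halts[OF start] run_result(1) start found_initial by metis
qed

end
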